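(* Let $\{F_n\}_{n\in\mathbb Z^+}$ be a sequence of non-negative measurable functions on $\mathbb T^\infty$. Then $$\lim_{T\to\infty}\frac1{2T}\int_{-T}^T\liminf_{n\to\infty}F_n(\chi\,\mathfrak p^{-it})\,\mathrm dt\le\liminf_{n\to\infty}\lim_{T\to\infty}\frac1{2T}\int_{-T}^TF_n(\chi\,\mathfrak p^{-it})\,\mathrm dt$$ for almost every $\chi\in\mathbb T^\infty$.
   Context: $\mathbb T$ is the unit circle in $\mathbb C$, $\mathbb T^\infty=\mathbb T\times\mathbb T\times\cdots$ is the countably infinite-dimensional torus (a compact abelian group under coordinatewise multiplication), and "measurable" and "almost every" refer to its normalized Haar measure $m_\infty$ (the product of the normalized arclength measures). The Kronecker flow is $\mathfrak p^{-it}=(2^{-it},3^{-it},5^{-it},\dots)\in\mathbb T^\infty$ for $t\in\mathbb R$ (the coordinates run over the primes); $\chi\,\mathfrak p^{-it}$ is the product in the group $\mathbb T^\infty$. Non-negative functions may take the value $+\infty$, and the limits and integrals are understood in $[0,\infty]$. *)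

theory Defs
  imports "HOL-Probability.Probability" "HOL-Computational_Algebra.Primes"
begin

text \<open>Normalized arclength on the unit circle, as the image of the uniform distribution on
  \<open>[0, 2\<pi>)\<close> under \<open>cis\<close>. The carrier is the circle itself, not the complex plane.\<close>

definition circle_measure :: "complex measure" where
  "circle_measure =
     distr (uniform_measure lborel {0..<2 * pi}) (restrict_space borel (sphere 0 1)) cis"

definition torus_measure :: "(nat \<Rightarrow> complex) measure" where
  "torus_measure = PiM UNIV (\<lambda>_. circle_measure)"

definition torus_mult :: "(nat \<Rightarrow> complex) \<Rightarrow> (nat \<Rightarrow> complex) \<Rightarrow> nat \<Rightarrow> complex" where
  "torus_mult z w = (\<lambda>j. z j * w j)"

text \<open>The \<open>j\<close>-th coordinate (counting from 0) belongs to the \<open>j\<close>-th prime in increasing order.\<close>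

definition kronecker_flow :: "real \<Rightarrow> nat \<Rightarrow> complex" where
  "kronecker_flow t =
     (\<lambda>j. of_nat (enumerate {p::nat. prime p} j) powr (- (\<i> * complex_of_real t)))"

definition flow_average ::
    "((nat \<Rightarrow> complex) \<Rightarrow> ennreal) \<Rightarrow> (nat \<Rightarrow> complex) \<Rightarrow> real \<Rightarrow> ennreal" where
  "flow_average G z T =
     ennreal (1 / (2 * T)) *
       (\<integral>\<^sup>+ t \<in> {-T..T}. G (torus_mult z (kronecker_flow t)) \<partial>lebesgue)"

lemma space_circle_measure: "space circle_measure = sphere 0 1"
  by (simp add: circle_measure_def space_restrict_space)

lemma space_torus_measure: "space torus_measure = {z. \<forall>j. cmod (z j) = 1}"
  by (auto simp: torus_measure_def space_PiM space_circle_measure PiE_def Pi_def)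

lemma prob_space_circle_measure: "prob_space circle_measure"
proof -
  have "prob_space (uniform_measure lborel {0..<2 * pi})"
    by (rule prob_space_uniform_measure) auto
  moreover have "cis \<in> measurable (uniform_measure lborel {0..<2 * pi})
      (restrict_space borel (sphere 0 1))"
  proof (rule measurable_restrict_space2)
    have "cis \<in> borel_measurable borel"
      by (intro borel_measurable_continuous_onI continuous_intros)
    then show "cis \<in> borel_measurable (uniform_measure lborel {0..<2 * pi})"
      by simp
  qed auto
  ultimately show ?thesis
    unfolding circle_measure_def by (rule prob_space.prob_space_distr)
qed

lemma prob_space_torus_measure: "prob_space torus_measure"
  unfolding torus_measure_def by (intro prob_space_PiM prob_space_circle_measure)

lemma kronecker_flow_in_torus: "kronecker_flow t \<in> space torus_measure"
proof -
  have pos: "enumerate {p::nat. prime p} j > 0" for j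
    using enumerate_in_set[OF primes_infinite, of j] prime_gt_0_nat by auto
  have "cmod (of_nat p powr (- (\<i> * complex_of_real t))) = 1" if "p > 0" for p :: nat
    using that norm_powr_real_powr'[of "of_nat p" "- (\<i> * complex_of_real t)"]
    by (simp add: norm_powr_real)
  with pos show ?thesis
    by (simp add: space_torus_measure kronecker_flow_def)
qed

end

theory Submission
  imports Defs
begin

text \<open>For a non-negative Borel function \<open>G\<close> on the torus, the averages of \<open>G\<close> along almost every orbit
of the Kronecker flow converge to \<open>\<integral>\<^sup>+ G\<close>, a possibly infinite constant
(\<open>kronecker_flow_average_converges\<close>). Given this, both sides of the claimed inequality are
almost everywhere equal to integrals over the torus, and the inequality is Fatou's lemma for the
Haar measure. Functions that are only measurable for the completed measure are replaced by Borel
functions that agree with them almost everywhere; since the flow preserves the measure, almost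
every orbit meets the exceptional null set in a null set of times, so no average changes
(\<open>flow_average_cong_AE\<close>).

The convergence theorem is the pointwise ergodic theorem for this flow. That the limit is the
integral comes from an explicit computation of the averages of characters. A character
takes the value \<open>(a/b)\<^sup>-\<^sup>i\<^sup>t\<close> at time \<open>t\<close> of the flow, where \<open>a\<close> and \<open>b\<close> are products of primes. By
unique factorisation \<open>a = b\<close> only for the trivial character, so for every other character the
averages tend to zero, as they should (\<open>orbit_mean_character\<close>). By the Stone--Weierstrass theorem, the
averages of a continuous function converge to its integral on every orbit
(\<open>continuous_orbit_mean\<close>).

A maximal inequality (\<open>flow_maximal_inequality\<close>) extends this to Borel functions: it implies that
the functions whose averages converge almost everywhere to their integral are closed under
increasing limits (\<open>averages_converge_SUP\<close>). Indicators of open sets are increasing limits of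
continuous functions, and a Dynkin argument followed by the usual approximation by simple functions
reaches all Borel functions (\<open>averages_converge_of_generator\<close>). This extension takes place in
\<open>[0, \<infinity>]\<close>, where an infinite integral only makes the upper bound for the averages vacuous.\<close>

section \<open>A maximal inequality for measure-preserving maps\<close>

text \<open>The function \<open>H n\<close> in the proof is the largest of the sums \<open>\<Sum>i<k. (g \<circ> S ^^ i - c)\<close> with
\<open>k \<le> n\<close>, the empty sum included. Defining it by a recursion with truncated subtraction keeps all values
in \<open>[0, \<infinity>]\<close>. With \<open>E n\<close> the set where the truncation does nothing, the recursion gives
\<open>c * indicator (E n) + H (Suc n) \<le> g + H n \<circ> S\<close>. Integrating, and cancelling
\<open>\<integral>\<^sup>+ H n \<circ> S = \<integral>\<^sup>+ H n \<le> \<integral>\<^sup>+ H (Suc n)\<close>, leaves \<open>c * emeasure M (E n) \<le> \<integral>\<^sup>+ g\<close>, and every point where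
some average of \<open>g\<close> reaches \<open>c\<close> lies in some \<open>E n\<close>. This is Garsia's argument.\<close>

lemma maximal_ergodic_inequality:
  fixes g :: "'a \<Rightarrow> ennreal"
  assumes S[measurable]: "S \<in> measurable M M" and pres: "distr M M S = M"
    and g[measurable]: "g \<in> borel_measurable M" and c: "c < top"
  shows "c * emeasure M {z \<in> space M. \<exists>n\<ge>1. of_nat n * c \<le> (\<Sum>k<n. g ((S ^^ k) z))} \<le> (\<integral>\<^sup>+z. g z \<partial>M)"
proof (cases "(\<integral>\<^sup>+z. g z \<partial>M) = top")
  case False
  define H where "H = rec_nat (\<lambda>z. 0) (\<lambda>_ h z. g z + h (S z) - c)"
  have H0: "H 0 z = 0" and HS: "H (Suc n) z = g z + H n (S z) - c" for n z
    by (simp_all add: H_def)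
  have [measurable]: "H n \<in> borel_measurable M" for n
  proof (induction n)
    case 0 then show ?case unfolding H0[abs_def] by simp
  next
    case (Suc n)
    note [measurable] = Suc
    show ?case unfolding HS[abs_def] by measurable
  qed
  define E where "E n = {z \<in> space M. c \<le> g z + H n (S z)}" for n
  have [measurable]: "E n \<in> sets M" for n
    unfolding E_def by measurable
  have mono: "H n z \<le> H (Suc n) z" for n z
  proof (induction n arbitrary: z)
    case (Suc n)
    show ?case unfolding HS[of "Suc n" z] HS[of n z]
      by (intro ennreal_minus_mono add_mono Suc order_refl)
  qed (simp add: H0)
  have inv: "(\<integral>\<^sup>+z. f (S z) \<partial>M) = (\<integral>\<^sup>+z. f z \<partial>M)" if [measurable]: "f \<in> borel_measurable M" for f :: "'a \<Rightarrow> ennreal"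
    by (subst (2) pres[symmetric]) (simp add: nn_integral_distr)
  have fin: "(\<integral>\<^sup>+z. H n z \<partial>M) < top" for n
  proof (induction n)
    case (Suc n)
    have "(\<integral>\<^sup>+z. H (Suc n) z \<partial>M) \<le> (\<integral>\<^sup>+z. g z + H n (S z) \<partial>M)"
      unfolding HS by (intro nn_integral_mono) (simp add: diff_le_self_ennreal)
    also have "\<dots> = (\<integral>\<^sup>+z. g z \<partial>M) + (\<integral>\<^sup>+z. H n z \<partial>M)"
      by (simp add: nn_integral_add inv)
    also have "\<dots> < top" using Suc False by (simp add: less_top)
    finally show ?case .
  qed (simp add: H0)
  have bound: "c * emeasure M (E n) \<le> (\<integral>\<^sup>+z. g z \<partial>M)" for n
  proof -
    have pt: "c * indicator (E n) z + H (Suc n) z \<le> g z + H n (S z)" if "z \<in> space M" for z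
    proof (cases "c \<le> g z + H n (S z)")
      case True
      then show ?thesis using that c by (simp add: E_def HS add_diff_inverse_ennreal)
    next
      case False
      then show ?thesis by (simp add: E_def HS diff_le_self_ennreal)
    qed
    have "c * emeasure M (E n) + (\<integral>\<^sup>+z. H (Suc n) z \<partial>M) = (\<integral>\<^sup>+z. c * indicator (E n) z + H (Suc n) z \<partial>M)"
      by (simp add: nn_integral_add nn_integral_cmult)
    also have "\<dots> \<le> (\<integral>\<^sup>+z. g z + H n (S z) \<partial>M)"
      by (intro nn_integral_mono pt)
    also have "\<dots> = (\<integral>\<^sup>+z. g z \<partial>M) + (\<integral>\<^sup>+z. H n z \<partial>M)"
      by (simp add: nn_integral_add inv)
    also have "\<dots> \<le> (\<integral>\<^sup>+z. g z \<partial>M) + (\<integral>\<^sup>+z. H (Suc n) z \<partial>M)"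
      by (intro add_mono nn_integral_mono mono order_refl)
    finally show ?thesis
      using fin[of "Suc n"]
      by (auto simp: add.commute[of _ "integral\<^sup>N M (H (Suc n))"] ennreal_add_left_cancel_le)
  qed
  \<comment> \<open>Applied at \<open>S z\<close>, this shows that \<open>z\<close> lies in \<open>E n\<close> if its average over \<open>n + 1\<close> steps reaches \<open>c\<close>.\<close>
  have sums: "(\<Sum>k<n. g ((S ^^ k) z)) \<le> of_nat n * c + H n z" for n z
  proof (induction n arbitrary: z)
    case (Suc n)
    have "(\<Sum>k<Suc n. g ((S ^^ k) z)) = g z + (\<Sum>k<n. g ((S ^^ k) (S z)))"
      by (simp add: sum.lessThan_Suc_shift funpow_Suc_right del: funpow.simps sum.lessThan_Suc)
    also have "\<dots> \<le> of_nat n * c + (g z + H n (S z))"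
      using add_left_mono[OF Suc[where z="S z"], of "g z"] by (simp only: ac_simps)
    also have "g z + H n (S z) \<le> c + H (Suc n) z"
      unfolding HS by (cases "c \<le> g z + H n (S z)") (simp_all add: add_diff_inverse_ennreal add_increasing2)
    finally show ?case by (simp add: algebra_simps)
  qed simp
  have sub: "{z \<in> space M. \<exists>n\<ge>1. of_nat n * c \<le> (\<Sum>k<n. g ((S ^^ k) z))} \<subseteq> (\<Union>n. E n)"
  proof safe
    fix z n assume z: "z \<in> space M" and n: "(1::nat) \<le> n" and le: "of_nat n * c \<le> (\<Sum>k<n. g ((S ^^ k) z))"
    obtain m where m: "n = Suc m" using n by (cases n) auto
    have "of_nat m * c + c \<le> (\<Sum>k<Suc m. g ((S ^^ k) z))"
      using le by (simp add: m algebra_simps)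
    also have "\<dots> = g z + (\<Sum>k<m. g ((S ^^ k) (S z)))"
      by (simp add: sum.lessThan_Suc_shift funpow_Suc_right del: funpow.simps sum.lessThan_Suc)
    also have "\<dots> \<le> of_nat m * c + (g z + H m (S z))"
      using add_left_mono[OF sums[where n=m and z="S z"], of "g z"] by (simp only: ac_simps)
    finally have "c \<le> g z + H m (S z)"
      using c by (auto simp: ennreal_add_left_cancel_le ennreal_mult_eq_top_iff)
    with z show "z \<in> (\<Union>n. E n)" by (auto simp: E_def)
  qed
  have inc: "incseq E"
    unfolding E_def incseq_Suc_iff using mono by (auto intro: order_trans add_left_mono)
  have "c * emeasure M {z \<in> space M. \<exists>n\<ge>1. of_nat n * c \<le> (\<Sum>k<n. g ((S ^^ k) z))} \<le> c * emeasure M (\<Union>n. E n)"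
    by (intro mult_left_mono emeasure_mono sub) auto
  also have "\<dots> = (SUP n. c * emeasure M (E n))"
    using inc by (subst SUP_emeasure_incseq[symmetric]) (auto simp: SUP_mult_left_ennreal)
  also have "\<dots> \<le> (\<integral>\<^sup>+z. g z \<partial>M)"
    by (intro SUP_least bound)
  finally show ?thesis .
qed simp

section \<open>Averages along a measure-preserving flow\<close>

locale measure_preserving_flow = prob_space M for M :: "'a measure" +
  fixes \<phi> :: "real \<Rightarrow> 'a \<Rightarrow> 'a"
  assumes measurable_flow: "(\<lambda>(t, z). \<phi> t z) \<in> measurable (borel \<Otimes>\<^sub>M M) M"
    and flow_preserves: "distr M M (\<phi> t) = M"
    and flow_0: "z \<in> space M \<Longrightarrow> \<phi> 0 z = z"
    and flow_add: "z \<in> space M \<Longrightarrow> \<phi> (s + t) z = \<phi> s (\<phi> t z)"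
begin

lemma measurable_flow'[measurable (raw)]:
  assumes [measurable]: "f \<in> measurable N borel" "h \<in> measurable N M"
  shows "(\<lambda>x. \<phi> (f x) (h x)) \<in> measurable N M"
proof -
  have "(\<lambda>x. case (f x, h x) of (t, z) \<Rightarrow> \<phi> t z) \<in> measurable N M"
    by (rule measurable_compose[OF _ measurable_flow]) measurable
  then show ?thesis by simp
qed

lemma flow_in_space: "z \<in> space M \<Longrightarrow> \<phi> t z \<in> space M"
  using measurable_space[OF measurable_flow'[of "\<lambda>_. t" M "\<lambda>z. z"]] by simp

lemma nn_integral_flow:
  assumes [measurable]: "f \<in> borel_measurable M"
  shows "(\<integral>\<^sup>+z. f (\<phi> t z) \<partial>M) = (\<integral>\<^sup>+z. f z \<partial>M)"
  by (subst (2) flow_preserves[of t, symmetric]) (simp add: nn_integral_distr)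

lemma flow_funpow:
  assumes "z \<in> space M"
  shows "(\<phi> s ^^ k) z = \<phi> (of_nat k * s) z"
  using assms
proof (induction k)
  case (Suc k)
  then show ?case by (simp add: flow_add[symmetric] algebra_simps)
qed (simp add: flow_0)

text \<open>Integrating \<open>G\<close> over the time window \<open>[-1, 1]\<close> gives a function \<open>g\<close> with \<open>\<integral>\<^sup>+ g = 2 * \<integral>\<^sup>+ G\<close>,
and the windows centred at the integers \<open>k\<close> with \<open>\<bar>k\<bar> < n\<close> cover \<open>[-n, n]\<close>. If the integral of \<open>G\<close>
over \<open>[-n, n]\<close> is at least \<open>n * c\<close>, the forward or the backward sum of \<open>g\<close> over \<open>n\<close> steps is therefore
at least \<open>n * (c / 2)\<close>. The discrete inequality for the maps \<open>\<phi> 1\<close> and \<open>\<phi> (-1)\<close> bounds both cases.\<close>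

lemma flow_maximal_inequality:
  fixes G :: "'a \<Rightarrow> ennreal" and c :: real
  assumes [measurable]: "G \<in> borel_measurable M" and c: "c \<ge> 0"
  shows "ennreal c * emeasure M {z \<in> space M. \<exists>n\<ge>1::nat. of_nat n * ennreal c \<le> (\<integral>\<^sup>+t\<in>{-real n..real n}. G (\<phi> t z) \<partial>lborel)}
      \<le> 8 * (\<integral>\<^sup>+z. G z \<partial>M)"
proof -
  define g where "g z = (\<integral>\<^sup>+t\<in>{-1..1}. G (\<phi> t z) \<partial>lborel)" for z
  have [measurable]: "g \<in> borel_measurable M"
    unfolding g_def by measurable
  have int_g: "(\<integral>\<^sup>+z. g z \<partial>M) = 2 * (\<integral>\<^sup>+z. G z \<partial>M)"
  proof -
    interpret P: pair_sigma_finite M lborel ..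
    have "(\<integral>\<^sup>+z. g z \<partial>M) = (\<integral>\<^sup>+t. (\<integral>\<^sup>+z. G (\<phi> t z) * indicator {-1..1} t \<partial>M) \<partial>lborel)"
      unfolding g_def by (intro P.Fubini'[symmetric]) measurable
    also have "\<dots> = (\<integral>\<^sup>+t. (\<integral>\<^sup>+z. G z \<partial>M) * indicator {-1..1::real} t \<partial>lborel)"
      by (intro nn_integral_cong) (simp add: nn_integral_multc nn_integral_flow)
    also have "\<dots> = 2 * (\<integral>\<^sup>+z. G z \<partial>M)"
      by (simp add: nn_integral_cmult mult.commute)
    finally show ?thesis .
  qed
  have g_flow: "g (\<phi> s z) = (\<integral>\<^sup>+t\<in>{s-1..s+1}. G (\<phi> t z) \<partial>lborel)" if z: "z \<in> space M" for s z
  proof -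
    note [measurable] = measurable_const[OF z]
    have "(\<integral>\<^sup>+t\<in>{s-1..s+1}. G (\<phi> t z) \<partial>lborel)
        = (\<integral>\<^sup>+t. G (\<phi> (s + t) z) * indicator {s-1..s+1} (s + t) \<partial>lborel)"
      using nn_integral_real_affine[of "\<lambda>t. G (\<phi> t z) * indicator {s-1..s+1} t" 1 s] by simp
    also have "\<dots> = g (\<phi> s z)"
      unfolding g_def
      by (intro nn_integral_cong arg_cong2[where f="(*)"])
         (auto simp: flow_add[OF z, symmetric] add.commute indicator_def)
    finally show ?thesis by simp
  qed
  have half: "ennreal c = ennreal (c/2) + ennreal (c/2)"
    using c by (simp flip: ennreal_plus)
  define E where "E s = {z \<in> space M. \<exists>n\<ge>1. of_nat n * ennreal (c/2) \<le> (\<Sum>k<n. g ((\<phi> s ^^ k) z))}" for s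
  have [measurable]: "E s \<in> sets M" for s
    unfolding E_def by measurable
  have E: "ennreal c * emeasure M (E s) \<le> 4 * (\<integral>\<^sup>+z. G z \<partial>M)" for s
  proof -
    have "ennreal (c/2) * emeasure M (E s) \<le> 2 * (\<integral>\<^sup>+z. G z \<partial>M)"
      unfolding E_def int_g[symmetric]
      by (intro maximal_ergodic_inequality flow_preserves) auto
    from add_mono[OF this this] show ?thesis
      by (simp add: half distrib_right[symmetric])
  qed
  have split: "(\<integral>\<^sup>+t\<in>{-real n..real n}. G (\<phi> t z) \<partial>lborel)
      \<le> (\<Sum>k<n. g (\<phi> (real k) z)) + (\<Sum>k<n. g (\<phi> (- real k) z))" if z: "z \<in> space M" for z n
  proof (induction n)
    case 0
    have "(\<integral>\<^sup>+t\<in>{0..0::real}. G (\<phi> t z) \<partial>lborel) = 0"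
      by (intro nn_integral_zero' ) (auto intro!: AE_I[of _ _ "{0}"] simp: indicator_def)
    then show ?case by simp
  next
    case (Suc n)
    note [measurable] = measurable_const[OF z]
    let ?I = "\<lambda>A. (\<integral>\<^sup>+t\<in>A. G (\<phi> t z) \<partial>lborel)"
    have "?I {-real (Suc n)..real (Suc n)} \<le>
      (\<integral>\<^sup>+t. G (\<phi> t z) * indicator {-real n..real n} t + (G (\<phi> t z) * indicator {real n - 1..real n + 1} t
          + G (\<phi> t z) * indicator {-real n - 1..-real n + 1} t) \<partial>lborel)"
      by (intro nn_integral_mono) (auto simp: indicator_def)
    also have "\<dots> = ?I {-real n..real n} + (g (\<phi> (real n) z) + g (\<phi> (- real n) z))"
      by (simp add: nn_integral_add g_flow[OF z])
    also have "\<dots> \<le> ((\<Sum>k<n. g (\<phi> (real k) z)) + (\<Sum>k<n. g (\<phi> (- real k) z))) + (g (\<phi> (real n) z) + g (\<phi> (- real n) z))"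
      by (intro add_right_mono Suc)
    finally show ?case by (simp add: ac_simps)
  qed
  have sub: "{z \<in> space M. \<exists>n\<ge>1::nat. of_nat n * ennreal c \<le> (\<integral>\<^sup>+t\<in>{-real n..real n}. G (\<phi> t z) \<partial>lborel)} \<subseteq> E 1 \<union> E (-1)"
  proof safe
    fix z and n :: nat assume z: "z \<in> space M" and n: "1 \<le> n"
      and le: "of_nat n * ennreal c \<le> (\<integral>\<^sup>+t\<in>{-real n..real n}. G (\<phi> t z) \<partial>lborel)" and nE: "z \<notin> E (-1)"
    show "z \<in> E 1"
    proof (rule ccontr)
      assume "z \<notin> E 1"
      with nE z n have *: "(\<Sum>k<n. g (\<phi> (real k) z)) < of_nat n * ennreal (c/2)"  "(\<Sum>k<n. g (\<phi> (- real k) z)) < of_nat n * ennreal (c/2)"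
        by (auto simp: E_def flow_funpow not_le dest!: spec[of _ n])
      have "(\<Sum>k<n. g (\<phi> (real k) z)) + (\<Sum>k<n. g (\<phi> (- real k) z)) < of_nat n * ennreal (c/2) + of_nat n * ennreal (c/2)"
        using * by (intro add_strict_mono)
      also have "\<dots> = of_nat n * ennreal c"
        by (simp only: half distrib_left)
      finally show False using le split[OF z, of n] by simp
    qed
  qed
  have "ennreal c * emeasure M {z \<in> space M. \<exists>n\<ge>1::nat. of_nat n * ennreal c \<le> (\<integral>\<^sup>+t\<in>{-real n..real n}. G (\<phi> t z) \<partial>lborel)}
     \<le> c * (emeasure M (E 1) + emeasure M (E (-1)))"
    by (intro mult_left_mono order_trans[OF emeasure_mono[OF sub]] emeasure_subadditive) auto
  also have "\<dots> \<le> 4 * (\<integral>\<^sup>+z. G z \<partial>M) + 4 * (\<integral>\<^sup>+z. G z \<partial>M)"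
    unfolding distrib_left by (intro add_mono E)
  also have "\<dots> = 8 * (\<integral>\<^sup>+z. G z \<partial>M)"
    by (simp add: distrib_right[symmetric])
  finally show ?thesis .
qed

text \<open>By Fubini: at each fixed time the flow preserves the measure, so the points that it moves into
a null set form a null set.\<close>

lemma AE_orbit:
  assumes "AE z in M. P z"
  shows "AE z in M. AE t in lborel. P (\<phi> t z)"
proof -
  obtain N where N: "\<And>z. z \<in> space M - N \<Longrightarrow> P z" "N \<in> null_sets M"
    by (rule AE_E3[OF assms], rule that)
  have [measurable]: "N \<in> sets M" using N(2) by auto
  interpret P: pair_sigma_finite M lborel ..
  have flow: "(\<lambda>z. \<phi> t z) \<in> measurable M M" for t by measurable
  have "AE z in M. \<phi> t z \<notin> N" for t
    by (rule AE_distrD[OF flow]) (unfold flow_preserves, rule AE_not_in[OF N(2)])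
  then have "AE t in lborel. AE z in M. \<phi> t z \<notin> N" by simp
  moreover have "{x \<in> space (M \<Otimes>\<^sub>M lborel). \<phi> (snd x) (fst x) \<notin> N} \<in> sets (M \<Otimes>\<^sub>M lborel)"
    by measurable
  ultimately have "AE z in M. AE t in lborel. \<phi> t z \<notin> N"
    using P.AE_commute[where P="\<lambda>z t. \<phi> t z \<notin> N"] by simp
  then show ?thesis
    using AE_space
  proof eventually_elim
    case (elim z)
    show ?case
      using elim(1) by eventually_elim (use N(1) flow_in_space[OF elim(2)] in auto)
  qed
qed

definition orbit_average :: "('a \<Rightarrow> ennreal) \<Rightarrow> 'a \<Rightarrow> real \<Rightarrow> ennreal" where
  "orbit_average G z T = ennreal (1 / (2 * T)) * (\<integral>\<^sup>+t\<in>{-T..T}. G (\<phi> t z) \<partial>lborel)"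

definition averages_converge :: "('a \<Rightarrow> ennreal) \<Rightarrow> bool" where
  "averages_converge G \<longleftrightarrow> (AE z in M. (orbit_average G z \<longlongrightarrow> (\<integral>\<^sup>+z. G z \<partial>M)) at_top)"

lemma orbit_average_cong:
  assumes "z \<in> space M" "\<And>w. w \<in> space M \<Longrightarrow> G w = H w"
  shows "orbit_average G z = orbit_average H z"
  unfolding orbit_average_def using assms by (simp add: flow_in_space)

lemma averages_converge_cong:
  assumes "\<And>w. w \<in> space M \<Longrightarrow> G w = H w"
  shows "averages_converge G \<longleftrightarrow> averages_converge H"
  unfolding averages_converge_def
  using assms by (intro AE_cong) (simp add: orbit_average_cong[of _ G H] cong: nn_integral_cong)

lemma orbit_average_mono:
  assumes "z \<in> space M" "\<And>w. w \<in> space M \<Longrightarrow> G w \<le> H w"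
  shows "orbit_average G z T \<le> orbit_average H z T"
  unfolding orbit_average_def using assms
  by (intro mult_left_mono nn_integral_mono mult_right_mono) (auto simp: flow_in_space)

lemma orbit_average_add:
  assumes z: "z \<in> space M" and [measurable]: "G \<in> borel_measurable M" "H \<in> borel_measurable M"
  shows "orbit_average (\<lambda>w. G w + H w) z T = orbit_average G z T + orbit_average H z T"
proof -
  note [measurable] = measurable_const[OF z]
  show ?thesis
    unfolding orbit_average_def by (simp add: distrib_right distrib_left nn_integral_add)
qed

lemma orbit_average_cmult:
  assumes z: "z \<in> space M" and [measurable]: "G \<in> borel_measurable M"
  shows "orbit_average (\<lambda>w. c * G w) z T = c * orbit_average G z T"
proof -
  note [measurable] = measurable_const[OF z]
  show ?thesis
    unfolding orbit_average_def
    by (simp only: mult.assoc[of c] mult.left_commute[of _ c]) (simp add: nn_integral_cmult mult.left_commute[of _ c])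
qed

lemma orbit_average_const:
  assumes "T > 0"
  shows "orbit_average (\<lambda>w. c) z T = c"
proof -
  have "orbit_average (\<lambda>w. c) z T = (ennreal (1 / (2 * T)) * ennreal (2 * T)) * c"
    unfolding orbit_average_def using assms by (simp add: nn_integral_cmult ac_simps)
  also have "ennreal (1 / (2 * T)) * ennreal (2 * T) = 1"
    using assms by (simp flip: ennreal_mult)
  finally show ?thesis by simp
qed

text \<open>An interval \<open>[-T, T]\<close> with \<open>T \<ge> 1\<close> lies in \<open>[-n, n]\<close> for an integer \<open>n \<le> 2 * T\<close>, so the averages
over real \<open>T\<close> are controlled by the integer times that appear in the maximal inequality.\<close>

lemma orbit_average_le:
  assumes T: "T \<ge> 1" and c: "c \<ge> 0"
    and le: "\<And>n::nat. n \<ge> 1 \<Longrightarrow> (\<integral>\<^sup>+t\<in>{-real n..real n}. G (\<phi> t z) \<partial>lborel) \<le> of_nat n * ennreal c"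
  shows "orbit_average G z T \<le> ennreal c"
proof -
  define n where "n = nat \<lceil>T\<rceil>"
  have n: "T \<le> real n" "real n \<le> 2 * T" "n \<ge> 1" using T by (auto simp: n_def) linarith+
  have "(\<integral>\<^sup>+t\<in>{-T..T}. G (\<phi> t z) \<partial>lborel) \<le> (\<integral>\<^sup>+t\<in>{-real n..real n}. G (\<phi> t z) \<partial>lborel)"
    using n by (intro nn_integral_mono) (auto simp: indicator_def)
  also have "\<dots> \<le> of_nat n * ennreal c" using n by (intro le) auto
  finally have "orbit_average G z T \<le> ennreal (1 / (2 * T)) * (of_nat n * ennreal c)"
    unfolding orbit_average_def by (intro mult_left_mono) auto
  also have "\<dots> = ennreal (real n / (2 * T) * c)"
    using T c by (simp add: ennreal_of_nat_eq_real_of_nat flip: ennreal_mult)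
  also have "\<dots> \<le> ennreal c"
    using T c n by (intro ennreal_leI mult_left_le_one_le) auto
  finally show ?thesis .
qed

lemma averages_converge_add:
  assumes [measurable]: "G \<in> borel_measurable M" "H \<in> borel_measurable M"
    and "averages_converge G" "averages_converge H"
  shows "averages_converge (\<lambda>w. G w + H w)"
  using assms(3,4) AE_space unfolding averages_converge_def
proof eventually_elim
  case (elim z)
  have "orbit_average (\<lambda>w. G w + H w) z = (\<lambda>T. orbit_average G z T + orbit_average H z T)"
    using elim(3) by (intro ext orbit_average_add) auto
  then show ?case
    using tendsto_add[OF elim(1,2)] by (simp add: nn_integral_add)
qed

lemma averages_converge_cmult:
  assumes [measurable]: "G \<in> borel_measurable M" and "c < top"
    and "averages_converge G"
  shows "averages_converge (\<lambda>w. c * G w)"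
  using assms(3) AE_space unfolding averages_converge_def
proof eventually_elim
  case (elim z)
  have "((\<lambda>T. c * orbit_average G z T) \<longlongrightarrow> c * (\<integral>\<^sup>+z. G z \<partial>M)) at_top"
    using assms(2) elim(1) by (rule ennreal_tendsto_cmult)
  moreover have "orbit_average (\<lambda>w. c * G w) z = (\<lambda>T. c * orbit_average G z T)"
    using elim(2) by (intro ext orbit_average_cmult) auto
  ultimately show ?case
    by (simp add: nn_integral_cmult)
qed

text \<open>The lower bound is monotonicity: \<open>G = (SUP i. U i)\<close> dominates every \<open>U i\<close>, and the integrals of the
\<open>U i\<close> increase to that of \<open>G\<close>. For the upper bound the integral of \<open>G\<close> may be taken finite, and then
\<open>h i = G - U i\<close> has integral tending to zero. By the maximal inequality, all averages of \<open>h i\<close> over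
\<open>[-T, T]\<close> with \<open>T \<ge> 1\<close> are at most a fixed \<open>c\<close> outside a set of measure at most \<open>8 / c\<close> times that
integral, and almost every point is outside this set for some \<open>i\<close>.\<close>

lemma averages_converge_SUP:
  fixes U :: "nat \<Rightarrow> 'a \<Rightarrow> ennreal"
  assumes [measurable]: "\<And>i. U i \<in> borel_measurable M"
    and inc: "incseq U" and conv: "\<And>i. averages_converge (U i)"
  shows "averages_converge (SUP i. U i)"
proof -
  define G where "G = (SUP i. U i)"
  have G_eq: "G w = (SUP i. U i w)" for w
    by (simp add: G_def image_comp)
  have [measurable]: "G \<in> borel_measurable M"
    unfolding G_eq[abs_def] by measurable
  have UG: "U i w \<le> G w" for i w
    unfolding G_eq by (rule SUP_upper) simp
  have int_G: "(\<integral>\<^sup>+w. G w \<partial>M) = (SUP i. \<integral>\<^sup>+w. U i w \<partial>M)"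
    unfolding G_eq by (intro nn_integral_monotone_convergence_SUP inc) measurable
  define h where "h i w = G w - U i w" for i w
  have [measurable]: "h i \<in> borel_measurable M" for i
    unfolding h_def by measurable
  define E where "E i c = {z \<in> space M. \<exists>n\<ge>1::nat. of_nat n * ennreal c \<le> (\<integral>\<^sup>+t\<in>{-real n..real n}. h i (\<phi> t z) \<partial>lborel)}" for i c
  have [measurable]: "E i c \<in> sets M" for i c
    unfolding E_def by measurable
  have ex_small: "AE z in M. \<exists>i. z \<notin> E i c" if fin: "(\<integral>\<^sup>+w. G w \<partial>M) < top" and c: "c > 0" for c
  proof -
    have int_h: "(\<lambda>i. \<integral>\<^sup>+w. h i w \<partial>M) \<longlonglongrightarrow> 0"
    proof -
      have eq: "(\<integral>\<^sup>+w. h i w \<partial>M) = (\<integral>\<^sup>+w. G w \<partial>M) - (\<integral>\<^sup>+w. U i w \<partial>M)" for i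
        unfolding h_def
      proof (intro nn_integral_diff)
        show "integral\<^sup>N M (U i) \<noteq> \<infinity>"
          using fin nn_integral_mono[of M "U i" G] UG by (auto simp: top_unique)
      qed (use UG in auto)
      have "(\<lambda>i. \<integral>\<^sup>+w. U i w \<partial>M) \<longlonglongrightarrow> (\<integral>\<^sup>+w. G w \<partial>M)"
        unfolding int_G by (intro LIMSEQ_SUP) (use inc in \<open>auto simp: incseq_def le_fun_def intro!: nn_integral_mono\<close>)
      then have "(\<lambda>i. (\<integral>\<^sup>+w. G w \<partial>M) - (\<integral>\<^sup>+w. U i w \<partial>M)) \<longlonglongrightarrow> (\<integral>\<^sup>+w. G w \<partial>M) - (\<integral>\<^sup>+w. G w \<partial>M)"
        using fin by (intro tendsto_diff_ennreal tendsto_const) auto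
      then show ?thesis using fin by (simp add: eq)
    qed
    have "ennreal c * emeasure M (\<Inter>i. E i c) \<le> 8 * (\<integral>\<^sup>+w. h i w \<partial>M)" for i
    proof -
      have "ennreal c * emeasure M (\<Inter>i. E i c) \<le> ennreal c * emeasure M (E i c)"
        by (intro mult_left_mono emeasure_mono) auto
      also have "\<dots> \<le> 8 * (\<integral>\<^sup>+w. h i w \<partial>M)"
        unfolding E_def using c by (intro flow_maximal_inequality) auto
      finally show ?thesis .
    qed
    moreover have "(\<lambda>i. 8 * (\<integral>\<^sup>+w. h i w \<partial>M)) \<longlonglongrightarrow> 8 * 0"
      using int_h by (intro ennreal_tendsto_cmult) auto
    ultimately have "ennreal c * emeasure M (\<Inter>i. E i c) \<le> 8 * 0"
      by (intro LIMSEQ_le_const) auto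
    then have "emeasure M (\<Inter>i. E i c) = 0"
      using c by simp
    then show ?thesis
      by (intro AE_I[of _ _ "\<Inter>i. E i c"]) auto
  qed
  have "AE z in M. \<forall>i. (orbit_average (U i) z \<longlongrightarrow> (\<integral>\<^sup>+w. U i w \<partial>M)) at_top"
    using conv by (simp add: AE_all_countable averages_converge_def)
  moreover have "AE z in M. (\<integral>\<^sup>+w. G w \<partial>M) < top \<longrightarrow> (\<forall>m. \<exists>i. z \<notin> E i (1 / real (Suc m)))"
    using ex_small by (cases "(\<integral>\<^sup>+w. G w \<partial>M) < top") (auto simp: AE_all_countable)
  ultimately show ?thesis
    unfolding averages_converge_def G_def[symmetric] using AE_space
  proof eventually_elim
    case (elim z)
    show ?case
    proof (rule order_tendstoI)
      fix a assume "a < (\<integral>\<^sup>+w. G w \<partial>M)"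
      then obtain i where "a < (\<integral>\<^sup>+w. U i w \<partial>M)"
        unfolding int_G by (auto simp: less_SUP_iff)
      with elim(1) have "\<forall>\<^sub>F T in at_top. a < orbit_average (U i) z T"
        by (auto dest: order_tendstoD)
      then show "\<forall>\<^sub>F T in at_top. a < orbit_average G z T"
        by eventually_elim (use orbit_average_mono[OF elim(3) UG] in \<open>auto intro: less_le_trans\<close>)
    next
      fix a assume a: "(\<integral>\<^sup>+w. G w \<partial>M) < a"
      have "(\<lambda>m. (\<integral>\<^sup>+w. G w \<partial>M) + ennreal (1 / real (Suc m))) \<longlonglongrightarrow> (\<integral>\<^sup>+w. G w \<partial>M) + ennreal 0"
        by (intro tendsto_add tendsto_const tendsto_ennrealI LIMSEQ_Suc lim_1_over_n)
      then have "\<forall>\<^sub>F m in sequentially. (\<integral>\<^sup>+w. G w \<partial>M) + ennreal (1 / real (Suc m)) < a"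
        using a by (intro order_tendstoD(2)) auto
      then obtain m where m: "(\<integral>\<^sup>+w. G w \<partial>M) + ennreal (1 / real (Suc m)) < a"
        by (auto simp: eventually_sequentially)
      have "(\<integral>\<^sup>+w. G w \<partial>M) < top" using a by (rule less_le_trans) simp
      with elim(2) obtain i where i: "z \<notin> E i (1 / real (Suc m))" by blast
      have small: "orbit_average (h i) z T \<le> ennreal (1 / real (Suc m))" if "T \<ge> 1" for T
      proof (rule orbit_average_le[OF that])
        fix n :: nat assume "1 \<le> n"
        then show "(\<integral>\<^sup>+t\<in>{-real n..real n}. h i (\<phi> t z) \<partial>lborel) \<le> of_nat n * ennreal (1 / real (Suc m))"
          using i elim(3) unfolding E_def by (blast intro: linear[THEN disjE])
      qed simp
      have "((\<lambda>T. orbit_average (U i) z T + ennreal (1 / real (Suc m))) \<longlongrightarrow> (\<integral>\<^sup>+w. U i w \<partial>M) + ennreal (1 / real (Suc m))) at_top"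
        using elim(1) by (intro tendsto_add tendsto_const) auto
      moreover have "(\<integral>\<^sup>+w. U i w \<partial>M) + ennreal (1 / real (Suc m)) < a"
        by (rule le_less_trans[OF _ m]) (intro add_right_mono nn_integral_mono UG)
      ultimately have "\<forall>\<^sub>F T in at_top. orbit_average (U i) z T + ennreal (1 / real (Suc m)) < a"
        by (rule order_tendstoD)
      then show "\<forall>\<^sub>F T in at_top. orbit_average G z T < a"
        using eventually_ge_at_top[of 1]
      proof eventually_elim
        case (elim T)
        have "orbit_average G z T = orbit_average (\<lambda>w. U i w + h i w) z T"
          unfolding h_def using UG by (simp add: add_diff_inverse_ennreal)
        also have "\<dots> = orbit_average (U i) z T + orbit_average (h i) z T"
          using \<open>z \<in> space M\<close> by (intro orbit_average_add) auto
        also have "\<dots> \<le> orbit_average (U i) z T + ennreal (1 / real (Suc m))"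
          using small elim by (intro add_left_mono) auto
        finally show ?case using elim by simp
      qed
    qed
  qed
qed

lemma averages_converge_compl:
  assumes [measurable]: "A \<in> sets M" and "averages_converge (indicator A)"
  shows "averages_converge (indicator (space M - A))"
  using assms(2) AE_space unfolding averages_converge_def
proof eventually_elim
  case (elim z)
  have one: "orbit_average (indicator A) z T + orbit_average (indicator (space M - A)) z T = 1" if "T > 0" for T
  proof -
    have "orbit_average (indicator A) z T + orbit_average (indicator (space M - A)) z T
        = orbit_average (\<lambda>w. indicator A w + indicator (space M - A) w) z T"
      using elim(2) by (intro orbit_average_add[symmetric]) auto
    also have "\<dots> = orbit_average (\<lambda>w. 1) z T"
      using elim(2) by (intro fun_cong[OF orbit_average_cong]) (auto simp: indicator_def)
    also have "\<dots> = 1" using that by (rule orbit_average_const)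
    finally show ?thesis .
  qed
  have "((\<lambda>T. 1 - orbit_average (indicator A) z T) \<longlongrightarrow> 1 - (\<integral>\<^sup>+w. indicator A w \<partial>M)) at_top"
    using elim(1) by (intro tendsto_diff_ennreal tendsto_const) auto
  moreover have "\<forall>\<^sub>F T in at_top. 1 - orbit_average (indicator A) z T = orbit_average (indicator (space M - A)) z T"
    using eventually_gt_at_top[of 0]
  proof eventually_elim
    case (elim T)
    have "orbit_average (indicator A) z T \<noteq> top" using one[OF elim] by auto
    then show ?case using one[OF elim] by (metis ennreal_add_diff_cancel_left)
  qed
  ultimately show ?case
    by (simp add: tendsto_cong emeasure_compl emeasure_space_1)
qed

text \<open>A substitute for ergodicity that can be checked on a generating family of sets: convergence to the
integral passes to complements and disjoint unions, hence to all measurable sets, and from there to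
all measurable functions.\<close>

theorem averages_converge_of_generator:
  assumes gen: "sets M = sigma_sets (space M) \<G>" and "Int_stable \<G>" "\<G> \<subseteq> Pow (space M)"
    and basic: "\<And>A. A \<in> \<G> \<Longrightarrow> averages_converge (indicator A)"
    and G: "G \<in> borel_measurable M"
  shows "averages_converge G"
proof -
  have zero: "averages_converge (\<lambda>_. 0)"
    by (simp add: averages_converge_def orbit_average_def[abs_def])
  have set: "averages_converge (indicator A)" if "A \<in> sets M" for A
    using assms(2,3) that[unfolded gen]
  proof (induction rule: sigma_sets_induct_disjoint)
    case (basic A) then show ?case by (rule assms(4))
  next
    case empty show ?case using zero by (simp add: indicator_def[abs_def])
  next
    case (compl A)
    then show ?case by (intro averages_converge_compl) (simp_all add: gen)
  next
    case (union A)
    then have [measurable]: "A i \<in> sets M" for i using gen by auto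
    define U where "U n = (\<lambda>w. \<Sum>i<n. indicator (A i) w :: ennreal)" for n
    have Um[measurable]: "U n \<in> borel_measurable M" for n
      unfolding U_def by measurable
    have "averages_converge (U n)" for n
    proof (induction n)
      case (Suc n)
      have "averages_converge (\<lambda>w. U n w + indicator (A n) w)"
        by (intro averages_converge_add Suc union) auto
      then show ?case by (simp add: U_def)
    qed (simp add: U_def zero)
    moreover have "incseq U"
      by (auto simp: U_def incseq_Suc_iff le_fun_def)
    ultimately have "averages_converge (SUP n. U n)"
      using Um by (intro averages_converge_SUP)
    also have "(SUP n. U n) = indicator (\<Union>i. A i)"
      using union(1) by (auto simp: fun_eq_iff U_def image_comp suminf_indicator simp flip: suminf_eq_SUP)
    finally show ?case .
  qed
  show ?thesis
    using G
  proof (induction rule: borel_measurable_induct)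
    case (cong f g)
    then show ?case by (metis averages_converge_cong)
  next
    case (set A) then show ?case by fact
  next
    case (mult u c) then show ?case by (intro averages_converge_cmult)
  next
    case (add u v) then show ?case by (intro averages_converge_add)
  next
    case (seq U) then show ?case by (intro averages_converge_SUP)
  qed
qed

end

section \<open>The Kronecker flow preserves Haar measure\<close>

lemma nn_integral_periodic_shift:
  fixes f :: "real \<Rightarrow> ennreal"
  assumes [measurable]: "f \<in> borel_measurable borel" and per: "\<And>x. f (x + p) = f x"
    and a: "0 \<le> a" "a \<le> p"
  shows "(\<integral>\<^sup>+x\<in>{0..<p}. f (a + x) \<partial>lborel) = (\<integral>\<^sup>+x\<in>{0..<p}. f x \<partial>lborel)"
proof -
  have shift: "(\<integral>\<^sup>+x\<in>{u..<v}. f (s + x) \<partial>lborel) = (\<integral>\<^sup>+x\<in>{s+u..<s+v}. f x \<partial>lborel)" for s u v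
  proof -
    have "(\<integral>\<^sup>+x\<in>{s+u..<s+v}. f x \<partial>lborel) = (\<integral>\<^sup>+x. f (s + x) * indicator {s+u..<s+v} (s + x) \<partial>lborel)"
      using nn_integral_real_affine[of "\<lambda>x. f x * indicator {s+u..<s+v} x" 1 s] by simp
    also have "\<dots> = (\<integral>\<^sup>+x\<in>{u..<v}. f (s + x) \<partial>lborel)"
      by (intro nn_integral_cong) (auto simp: indicator_def)
    finally show ?thesis ..
  qed
  have split: "(\<integral>\<^sup>+x\<in>{u..<v}. f x \<partial>lborel) + (\<integral>\<^sup>+x\<in>{v..<w}. f x \<partial>lborel) = (\<integral>\<^sup>+x\<in>{u..<w}. f x \<partial>lborel)"
    if "u \<le> v" "v \<le> w" for u v w
    using that by (subst nn_integral_add[symmetric]) (auto intro!: nn_integral_cong simp: indicator_def)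
  have "(\<integral>\<^sup>+x\<in>{0..<p}. f (a + x) \<partial>lborel) = (\<integral>\<^sup>+x\<in>{a..<p}. f x \<partial>lborel) + (\<integral>\<^sup>+x\<in>{p..<a+p}. f x \<partial>lborel)"
    using a by (simp add: shift split)
  also have "(\<integral>\<^sup>+x\<in>{p..<a+p}. f x \<partial>lborel) = (\<integral>\<^sup>+x\<in>{0..<a}. f x \<partial>lborel)"
    using shift[where s=p and u=0 and v=a] per by (simp add: add.commute[of p])
  also have "(\<integral>\<^sup>+x\<in>{a..<p}. f x \<partial>lborel) + \<dots> = (\<integral>\<^sup>+x\<in>{0..<p}. f x \<partial>lborel)"
    using a by (simp add: add.commute split)
  finally show ?thesis .
qed

lemma sets_circle_measure [measurable_cong]: "sets circle_measure = sets (restrict_space borel (sphere 0 1))"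
  by (simp add: circle_measure_def)

lemma measurable_circle_measureI:
  assumes "f \<in> borel_measurable N" "\<And>x. x \<in> space N \<Longrightarrow> cmod (f x) = 1"
  shows "f \<in> measurable N circle_measure"
  using assms by (subst measurable_cong_sets[OF refl sets_circle_measure], intro measurable_restrict_space2) auto

lemma measurable_circle_measureD:
  assumes "f \<in> measurable N circle_measure"
  shows "f \<in> borel_measurable N"
  using assms unfolding measurable_cong_sets[OF refl sets_circle_measure] by (simp add: measurable_restrict_space2_iff)

lemma measurable_circle_rotation:
  assumes "cmod w = 1"
  shows "(\<lambda>z. z * w) \<in> measurable circle_measure circle_measure"
proof (rule measurable_circle_measureI)
  have [measurable]: "(\<lambda>z. z) \<in> borel_measurable circle_measure"
    by (rule measurable_circle_measureD) simp
  show "(\<lambda>z. z * w) \<in> borel_measurable circle_measure" by measurable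
qed (use assms in \<open>simp add: space_circle_measure norm_mult\<close>)

text \<open>In the coordinate \<open>cis\<close>, a rotation is a translation of a \<open>2 * pi\<close>-periodic function.\<close>

lemma distr_circle_measure_rotation:
  assumes w: "cmod w = 1"
  shows "distr circle_measure circle_measure (\<lambda>z. z * w) = circle_measure"
proof -
  note [measurable] = measurable_circle_rotation[OF w]
  have cis: "cis \<in> measurable borel circle_measure"
    by (intro measurable_circle_measureI borel_measurable_continuous_onI continuous_intros) auto
  have "w \<noteq> 0" using w by auto
  then have cisw: "cis (Arg w) = w" using w by (simp add: cis_Arg sgn_div_norm)
  obtain a where a: "0 \<le> a" "a \<le> 2 * pi" "w = cis a"
  proof (cases "Arg w \<ge> 0")
    case True
    then show ?thesis using that[of "Arg w"] Arg_bounded[of w] cisw by auto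
  next
    case False
    have "cis (Arg w + 2 * pi) = w"
      using cisw by (simp flip: cis_mult)
    then show ?thesis using that[of "Arg w + 2 * pi"] False Arg_bounded[of w] by auto
  qed
  have int: "(\<integral>\<^sup>+z. h z \<partial>circle_measure) = (\<integral>\<^sup>+x\<in>{0..<2*pi}. h (cis x) \<partial>lborel) / ennreal (2 * pi)"
    if h: "h \<in> borel_measurable circle_measure" for h :: "complex \<Rightarrow> ennreal"
  proof -
    have c: "cis \<in> measurable (uniform_measure lborel {0..<2*pi}) (restrict_space borel (sphere 0 1))"
      using cis by (simp cong: measurable_cong_sets add: measurable_cong_sets[OF refl sets_circle_measure])
    have [measurable]: "(\<lambda>x. h (cis x)) \<in> borel_measurable borel"
      using measurable_compose[OF cis h] .
    show ?thesis
      unfolding circle_measure_def nn_integral_distr[OF c h[unfolded circle_measure_def]]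
      by (subst nn_integral_uniform_measure) auto
  qed
  show ?thesis
  proof (rule measure_eqI)
    fix A assume "A \<in> sets (distr circle_measure circle_measure (\<lambda>z. z * w))"
    then have [measurable]: "A \<in> sets circle_measure" by simp
    have [measurable]: "(\<lambda>x. indicator A (cis x) :: ennreal) \<in> borel_measurable borel"
      by (rule measurable_compose[OF cis]) measurable
    have rot: "(\<lambda>z. indicator A (z * w) :: ennreal) \<in> borel_measurable circle_measure"
      by (rule measurable_compose[OF measurable_circle_rotation[OF w]]) simp
    have "emeasure (distr circle_measure circle_measure (\<lambda>z. z * w)) A
        = (\<integral>\<^sup>+z. indicator A z \<partial>distr circle_measure circle_measure (\<lambda>z. z * w))"
      by (rule nn_integral_indicator[symmetric]) simp
    also have "\<dots> = (\<integral>\<^sup>+z. indicator A (z * w) \<partial>circle_measure)"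
      by (rule nn_integral_distr) (simp_all add: measurable_circle_rotation[OF w])
    also have "\<dots> = (\<integral>\<^sup>+x\<in>{0..<2*pi}. indicator A (cis (a + x)) \<partial>lborel) / ennreal (2 * pi)"
      unfolding int[OF rot] by (simp add: a(3) cis_mult add.commute)
    also have "(\<integral>\<^sup>+x\<in>{0..<2*pi}. indicator A (cis (a + x)) \<partial>lborel) = (\<integral>\<^sup>+x\<in>{0..<2*pi}. indicator A (cis x) \<partial>lborel)"
      using a by (intro nn_integral_periodic_shift) (auto simp flip: cis_mult)
    also have "\<dots> / ennreal (2 * pi) = emeasure circle_measure A"
      by (subst int[symmetric]) simp_all
    finally show "emeasure (distr circle_measure circle_measure (\<lambda>z. z * w)) A = emeasure circle_measure A" .
  qed simp
qed

lemma measurable_torus_measureI: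
  assumes "\<And>j. (\<lambda>x. f x j) \<in> borel_measurable N" "\<And>x j. x \<in> space N \<Longrightarrow> cmod (f x j) = 1"
  shows "f \<in> measurable N torus_measure"
  unfolding torus_measure_def
  by (rule measurable_PiM_single'[where f="\<lambda>j x. f x j"])
     (use assms in \<open>auto intro!: measurable_circle_measureI simp: space_circle_measure\<close>)

lemma measurable_torus_coordinate [measurable]: "(\<lambda>z. z j) \<in> borel_measurable torus_measure"
  unfolding torus_measure_def by (rule measurable_circle_measureD) measurable

lemma measurable_torus_coordinate' [measurable (raw)]:
  assumes "f \<in> measurable N torus_measure"
  shows "(\<lambda>x. f x j) \<in> borel_measurable N"
  using measurable_compose[OF assms measurable_torus_coordinate] .

text \<open>A measure on the infinite product is determined by its values on cylinder sets, and the preimage of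
a cylinder under a translation is the cylinder of the rotated sides.\<close>

lemma distr_torus_measure_translation:
  assumes w: "w \<in> space torus_measure"
  shows "distr torus_measure torus_measure (\<lambda>z. torus_mult z w) = torus_measure"
proof -
  have w1: "cmod (w j) = 1" for j using w by (simp add: space_torus_measure)
  have [measurable]: "(\<lambda>z. torus_mult z w) \<in> measurable torus_measure torus_measure"
    by (rule measurable_torus_measureI) (use w1 in \<open>auto simp: torus_mult_def space_torus_measure norm_mult\<close>)
  interpret prob_space circle_measure by (rule prob_space_circle_measure)
  interpret product_prob_space "\<lambda>_::nat. circle_measure" UNIV ..
  have "distr torus_measure torus_measure (\<lambda>z. torus_mult z w) = PiM UNIV (\<lambda>_. circle_measure)"
  proof (rule PiM_eq)
    fix J :: "nat set" and F assume J: "finite J" and F: "\<And>j. j \<in> J \<Longrightarrow> F j \<in> sets circle_measure"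
    define F' where "F' j = (\<lambda>z. z * w j) -` F j \<inter> space circle_measure" for j
    have F': "F' j \<in> sets circle_measure" if "j \<in> J" for j
      unfolding F'_def using measurable_circle_rotation[OF w1] F[OF that] by (rule measurable_sets)
    have emF': "emeasure circle_measure (F' j) = emeasure circle_measure (F j)" if "j \<in> J" for j
      unfolding F'_def using F[OF that]
      by (subst emeasure_distr[OF measurable_circle_rotation[OF w1], symmetric])
         (simp_all add: distr_circle_measure_rotation[OF w1])
    have pre: "(\<lambda>z. torus_mult z w) -` prod_emb UNIV (\<lambda>_. circle_measure) J (Pi\<^sub>E J F) \<inter> space torus_measure
        = prod_emb UNIV (\<lambda>_. circle_measure) J (Pi\<^sub>E J F')"
      by (auto simp: prod_emb_def F'_def space_torus_measure space_PiM space_circle_measure torus_mult_def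
            PiE_iff extensional_def norm_mult w1 split: if_splits)
    have "prod_emb UNIV (\<lambda>_. circle_measure) J (Pi\<^sub>E J F) \<in> sets torus_measure"
      unfolding torus_measure_def using J F by (intro sets_PiM_I) auto
    then show "emeasure (distr torus_measure torus_measure (\<lambda>z. torus_mult z w)) (emb UNIV J (Pi\<^sub>E J F))
        = (\<Prod>j\<in>J. emeasure circle_measure (F j))"
      using J F' emF' by (subst emeasure_distr) (auto simp: pre, auto simp: torus_measure_def emeasure_PiM_emb)
  qed (simp add: torus_measure_def)
  then show ?thesis by (simp add: torus_measure_def)
qed

abbreviation nth_prime :: "nat \<Rightarrow> nat" where
  "nth_prime \<equiv> enumerate {p. prime p}"

lemma prime_nth_prime: "prime (nth_prime j)"
  using enumerate_in_set[OF primes_infinite, of j] by simp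

text \<open>In this form the group law of the flow, its measurability and its continuity in \<open>t\<close> are visible.\<close>

lemma kronecker_flow_eq_cis: "kronecker_flow t j = cis (- t * ln (real (nth_prime j)))"
proof -
  have "real (nth_prime j) > 0" using prime_gt_0_nat[OF prime_nth_prime[of j]] by simp
  then show ?thesis
    by (simp add: kronecker_flow_def powr_def cis_conv_exp mult.assoc)
qed

interpretation kronecker: measure_preserving_flow torus_measure "\<lambda>t z. torus_mult z (kronecker_flow t)"
proof -
  interpret prob_space torus_measure by (rule prob_space_torus_measure)
  show "measure_preserving_flow torus_measure (\<lambda>t z. torus_mult z (kronecker_flow t))"
  proof
    show "(\<lambda>(t, z). torus_mult z (kronecker_flow t)) \<in> measurable (borel \<Otimes>\<^sub>M torus_measure) torus_measure"
    proof (rule measurable_torus_measureI)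
      fix j
      have [measurable]: "cis \<in> borel_measurable borel"
        by (intro borel_measurable_continuous_onI continuous_intros)
      show "(\<lambda>x. (case x of (t, z) \<Rightarrow> torus_mult z (kronecker_flow t)) j) \<in> borel_measurable (borel \<Otimes>\<^sub>M torus_measure)"
        unfolding torus_mult_def kronecker_flow_eq_cis case_prod_beta by measurable
    qed (auto simp: space_pair_measure space_torus_measure torus_mult_def norm_mult kronecker_flow_eq_cis)
    show "distr torus_measure torus_measure (\<lambda>z. torus_mult z (kronecker_flow t)) = torus_measure" for t
      by (rule distr_torus_measure_translation[OF kronecker_flow_in_torus])
  qed (auto simp: torus_mult_def kronecker_flow_eq_cis cis_mult algebra_simps)
qed

lemma flow_average_eq_orbit_average: "flow_average G z = kronecker.orbit_average G z"
  by (simp add: fun_eq_iff flow_average_def kronecker.orbit_average_def nn_integral_completion)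

section \<open>Characters and their averages\<close>

text \<open>The characters of the torus are the monomials in the coordinates and their conjugates. Multisets of
coordinate indices record the exponents: multiplying characters adds multisets, and
\<open>prime_product\<close> below turns a multiset into the integer with these prime factors. The
representation is redundant, \<open>(A, B)\<close> and \<open>(A + C, B + C)\<close> being the same function on the torus.\<close>

definition character :: "nat multiset \<Rightarrow> nat multiset \<Rightarrow> (nat \<Rightarrow> complex) \<Rightarrow> complex" where
  "character A B z = (\<Prod>j\<in>#A. z j) * cnj (\<Prod>j\<in>#B. z j)"

lemma character_mult: "character A B z * character A' B' z = character (A + A') (B + B') z"
  by (simp add: character_def)

lemma cnj_character: "cnj (character A B z) = character B A z"
  by (simp add: character_def)

lemma character_torus_mult: "character A B (torus_mult z w) = character A B z * character A B w"
  by (simp add: character_def torus_mult_def prod_mset.distrib)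

lemma continuous_on_character [continuous_intros]: "continuous_on S (character A B)"
proof -
  have coord: "continuous_on S (\<lambda>z. z j)" for j :: nat and S :: "(nat \<Rightarrow> complex) set"
    by (rule continuous_on_subset[OF continuous_on_product_coordinates]) simp
  have "continuous_on S (\<lambda>z. \<Prod>j\<in>#A. z j :: complex)" for A :: "nat multiset" and S
    by (induction A) (auto intro!: continuous_intros coord)
  then show ?thesis
    unfolding character_def[abs_def] by (intro continuous_intros)
qed

lemma norm_character:
  assumes "z \<in> space torus_measure"
  shows "cmod (character A B z) = 1"
proof -
  have "cmod (\<Prod>j\<in>#A. z j) = 1" for A
    using assms by (induction A) (auto simp: space_torus_measure norm_mult)
  then show ?thesis by (simp add: character_def norm_mult)
qed

lemma character_diagonal:
  assumes "z \<in> space torus_measure"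
  shows "character A A z = 1"
  using norm_character[OF assms, of A "{#}"]
  by (simp add: character_def complex_norm_square[symmetric])

definition prime_product :: "nat multiset \<Rightarrow> nat" where
  "prime_product A = (\<Prod>j\<in>#A. nth_prime j)"

lemma prime_product_pos: "prime_product A > 0"
  unfolding prime_product_def using prime_gt_0_nat[OF prime_nth_prime] by (induction A) auto

text \<open>This is unique factorisation, and it expresses that the logarithms of the primes are linearly
independent over the rationals.\<close>

lemma inj_prime_product: "inj prime_product"
proof (rule injI)
  fix A B assume eq: "prime_product A = prime_product B"
  have "prime_factorization (prime_product A) = image_mset nth_prime A" for A
    unfolding prime_product_def
    by (rule prime_factorization_prod_mset_primes) (auto simp: prime_nth_prime)
  with eq have "image_mset nth_prime A = image_mset nth_prime B" by metis
  moreover have "inj nth_prime" by (rule inj_enumerate[OF primes_infinite])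
  ultimately show "A = B" by (metis inj_eq multiset.inj_map)
qed

lemma character_kronecker_flow:
  "character A B (kronecker_flow t) = cis (- t * (ln (prime_product A) - ln (prime_product B)))"
proof -
  have "(\<Prod>j\<in>#A. kronecker_flow t j) = cis (- t * ln (prime_product A))" for A
  proof (induction A)
    case (add j A)
    have "prime_product (add_mset j A) = nth_prime j * prime_product A"
      by (simp add: prime_product_def)
    then have "ln (prime_product (add_mset j A)) = ln (real (nth_prime j)) + ln (real (prime_product A))"
      using prime_product_pos[of A] prime_gt_0_nat[OF prime_nth_prime[of j]]
      by (simp add: ln_mult)
    then show ?case
      using add by (simp add: kronecker_flow_eq_cis cis_mult algebra_simps)
  qed (simp add: prime_product_def)
  then show ?thesis
    by (simp add: character_def cis_cnj cis_mult algebra_simps)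
qed

lemma measurable_torus_borel: "(\<lambda>z. z) \<in> borel_measurable torus_measure"
proof -
  have "(\<lambda>z. z) \<in> measurable torus_measure (PiM UNIV (\<lambda>_. borel))"
    by (rule measurable_PiM_single'[where f="\<lambda>j z. z j"]) auto
  then show ?thesis
    by (simp add: measurable_cong_sets[OF refl sets_PiM_equal_borel])
qed

lemma borel_measurable_continuous_torus:
  fixes f :: "(nat \<Rightarrow> complex) \<Rightarrow> 'b::topological_space"
  assumes "continuous_on UNIV f"
  shows "f \<in> borel_measurable torus_measure"
  using measurable_compose[OF measurable_torus_borel borel_measurable_continuous_onI[OF assms]] .

lemma compact_torus: "compact (space torus_measure)"
proof -
  have "space torus_measure = PiE UNIV (\<lambda>_. sphere 0 1)"
    by (auto simp: space_torus_measure PiE_iff)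
  then show ?thesis
    using compactin_PiE[of "\<lambda>_. euclidean" UNIV "\<lambda>_::nat. sphere (0::complex) 1"]
    by (simp add: euclidean_product_topology)
qed

lemma integrable_continuous_torus:
  fixes f :: "(nat \<Rightarrow> complex) \<Rightarrow> 'b::{banach, second_countable_topology}"
  assumes "continuous_on UNIV f"
  shows "integrable torus_measure f"
proof -
  have "bounded (f ` space torus_measure)"
    by (intro compact_imp_bounded compact_continuous_image compact_torus continuous_on_subset[OF assms]) auto
  then obtain B where "\<And>z. z \<in> space torus_measure \<Longrightarrow> norm (f z) \<le> B"
    by (auto simp: bounded_iff)
  then show ?thesis
    using borel_measurable_continuous_torus[OF assms]
    by (intro kronecker.integrable_const_bound[of _ B]) auto
qed

lemma continuous_on_orbit:
  assumes "continuous_on UNIV f"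
  shows "continuous_on S (\<lambda>t. f (torus_mult z (kronecker_flow t)))"
proof -
  have "continuous_on S (\<lambda>t. torus_mult z (kronecker_flow t))"
    unfolding torus_mult_def kronecker_flow_eq_cis by (intro continuous_intros)
  from continuous_on_compose2[OF assms this] show ?thesis by auto
qed

text \<open>The averages of complex-valued functions. Characters are smooth along orbits, and the gauge integral
gives direct access to the fundamental theorem of calculus.\<close>

definition orbit_mean :: "((nat \<Rightarrow> complex) \<Rightarrow> 'b::real_normed_vector) \<Rightarrow> (nat \<Rightarrow> complex) \<Rightarrow> real \<Rightarrow> 'b" where
  "orbit_mean f z T = (1 / (2 * T)) *\<^sub>R integral {-T..T} (\<lambda>t. f (torus_mult z (kronecker_flow t)))"

lemma integrable_on_orbit:
  fixes f :: "(nat \<Rightarrow> complex) \<Rightarrow> 'b::banach"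
  assumes "continuous_on UNIV f"
  shows "(\<lambda>t. f (torus_mult z (kronecker_flow t))) integrable_on {a..b}"
  by (intro integrable_continuous_real continuous_on_orbit assms)

lemma torus_mult_flow_in_space:
  "z \<in> space torus_measure \<Longrightarrow> torus_mult z (kronecker_flow t) \<in> space torus_measure"
  by (rule kronecker.flow_in_space)

text \<open>On the orbit of \<open>z\<close> the character is \<open>character A B z * cis (- t * \<omega>)\<close> with
\<open>\<omega> = ln (prime_product A) - ln (prime_product B)\<close>, and \<open>\<omega> = 0\<close> only if \<open>A = B\<close>, when the character
is identically 1 on the torus. For \<open>\<omega> \<noteq> 0\<close> the integral of the oscillation over \<open>[-T, T]\<close> stays bounded,
so the means vanish in the limit; the integral over the torus vanishes because following the flow
for the time \<open>pi / \<omega>\<close> changes the sign of the character but not its integral.\<close>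

lemma orbit_mean_character:
  assumes z: "z \<in> space torus_measure"
  shows "(orbit_mean (character A B) z \<longlongrightarrow> (LINT w|torus_measure. character A B w)) at_top"
proof (cases "A = B")
  case True
  have "(LINT w|torus_measure. character A B w) = (LINT w|torus_measure. 1)"
    using True by (intro Bochner_Integration.integral_cong) (auto simp: character_diagonal)
  moreover have "\<forall>\<^sub>F T in at_top. orbit_mean (character A B) z T = 1"
    using eventually_gt_at_top[of 0]
    by eventually_elim (simp add: orbit_mean_def True character_diagonal torus_mult_flow_in_space[OF z])
  ultimately show ?thesis
    by (simp add: kronecker.prob_space tendsto_eventually)
next
  case False
  define \<omega> where "\<omega> = ln (prime_product A) - ln (prime_product B)"
  have \<omega>: "\<omega> \<noteq> 0"
    using False inj_prime_product prime_product_pos[of A] prime_product_pos[of B]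
    by (auto simp: \<omega>_def inj_eq)
  have orb: "character A B (torus_mult w (kronecker_flow t)) = character A B w * cis (- t * \<omega>)" for w t
    by (simp add: character_torus_mult character_kronecker_flow \<omega>_def)
  let ?I = "LINT w|torus_measure. character A B w"
  have "?I = (LINT w|distr torus_measure torus_measure (\<lambda>w. torus_mult w (kronecker_flow (pi / \<omega>))). character A B w)"
    by (simp add: kronecker.flow_preserves)
  also have "\<dots> = (LINT w|torus_measure. character A B (torus_mult w (kronecker_flow (pi / \<omega>))))"
    by (rule integral_distr)
       (auto intro!: borel_measurable_continuous_torus continuous_intros
          kronecker.measurable_flow'[of "\<lambda>_. pi / \<omega>" torus_measure "\<lambda>w. w"])
  also have "\<dots> = (LINT w|torus_measure. - character A B w)"
    using \<omega> unfolding orb by (simp flip: cis_cnj)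
  also have "\<dots> = - ?I" by simp
  finally have I: "?I = 0" by simp
  have bound: "norm (integral {-T..T} (\<lambda>t. character A B (torus_mult z (kronecker_flow t)))) \<le> 2 / \<bar>\<omega>\<bar>" if "T > 0" for T
  proof -
    define a where "a = - \<i> * complex_of_real \<omega>"
    have a: "a \<noteq> 0" "norm a = \<bar>\<omega>\<bar>" using \<omega> by (auto simp: a_def norm_mult)
    have cis_a: "cis (- t * \<omega>) = exp (a * of_real t)" for t
      by (simp add: a_def cis_conv_exp ac_simps)
    define F where "F t = character A B z * exp (a * of_real t) / a" for t :: real
    have norm_F: "norm (F t) = 1 / \<bar>\<omega>\<bar>" for t
      unfolding F_def cis_a[symmetric] by (simp add: norm_mult norm_divide norm_character[OF z] a)
    have "((\<lambda>t. character A B (torus_mult z (kronecker_flow t))) has_integral (F T - F (-T))) {-T..T}"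
    proof (rule fundamental_theorem_of_calculus)
      fix t assume "t \<in> {-T..T}"
      have "((\<lambda>s. character A B z * exp (a * s) / a) has_field_derivative
          character A B z * exp (a * of_real t)) (at (of_real t))"
        using a(1) by (auto intro!: derivative_eq_intros)
      from has_vector_derivative_real_field[OF this]
      show "(F has_vector_derivative character A B (torus_mult z (kronecker_flow t))) (at t within {-T..T})"
        unfolding F_def[abs_def] orb cis_a .
    qed (use that in simp)
    then have "norm (integral {-T..T} (\<lambda>t. character A B (torus_mult z (kronecker_flow t)))) = norm (F T - F (-T))"
      by (simp add: integral_unique)
    also have "\<dots> \<le> norm (F T) + norm (F (-T))" by (rule norm_triangle_ineq4)
    also have "\<dots> = 2 / \<bar>\<omega>\<bar>"
      unfolding norm_F by simp
    finally show ?thesis .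
  qed
  have "(orbit_mean (character A B) z \<longlongrightarrow> 0) at_top"
  proof (rule Lim_null_comparison)
    show "\<forall>\<^sub>F T in at_top. norm (orbit_mean (character A B) z T) \<le> (1 / \<bar>\<omega>\<bar>) * inverse T"
      using eventually_gt_at_top[of 0]
    proof eventually_elim
      case (elim T)
      have "norm (orbit_mean (character A B) z T) \<le> (1 / (2 * T)) * (2 / \<bar>\<omega>\<bar>)"
        unfolding orbit_mean_def norm_scaleR using elim bound[OF elim] by (intro mult_mono) auto
      then show ?case using elim by (simp add: field_simps)
    qed
    show "((\<lambda>T. (1 / \<bar>\<omega>\<bar>) * inverse T) \<longlongrightarrow> 0) at_top"
      by (intro tendsto_mult_right_zero tendsto_inverse_0_at_top filterlim_ident)
  qed
  then show ?thesis by (simp add: I)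
qed

section \<open>Continuous functions\<close>

inductive trig_poly :: "((nat \<Rightarrow> complex) \<Rightarrow> complex) \<Rightarrow> bool" where
  trig_poly_monomial: "trig_poly (\<lambda>z. c * character A B z)"
| trig_poly_add: "trig_poly P \<Longrightarrow> trig_poly Q \<Longrightarrow> trig_poly (\<lambda>z. P z + Q z)"

lemma continuous_on_trig_poly:
  assumes "trig_poly P" shows "continuous_on S P"
  using assms by induction (auto intro!: continuous_intros)

lemma trig_poly_mult:
  assumes "trig_poly P" "trig_poly Q" shows "trig_poly (\<lambda>z. P z * Q z)"
  using assms(1)
proof induction
  case (trig_poly_monomial c A B)
  show ?case using assms(2)
  proof induction
    case (trig_poly_monomial d A' B')
    show ?case
      using trig_poly.trig_poly_monomial[of "c * d" "A + A'" "B + B'"]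
      by (simp add: character_mult[symmetric] ac_simps)
  qed (simp add: distrib_left trig_poly.trig_poly_add)
qed (simp add: distrib_right trig_poly.trig_poly_add)

lemma trig_poly_cnj:
  assumes "trig_poly P" shows "trig_poly (\<lambda>z. cnj (P z))"
  using assms by induction (auto simp: cnj_character intro: trig_poly.intros)

lemma trig_poly_const: "trig_poly (\<lambda>_. c)"
  using trig_poly_monomial[of c "{#}" "{#}"] by (simp add: character_def)

lemma trig_poly_orbit_mean:
  assumes z: "z \<in> space torus_measure" and "trig_poly P"
  shows "(orbit_mean P z \<longlongrightarrow> (LINT w|torus_measure. P w)) at_top"
  using assms(2)
proof induction
  case (trig_poly_monomial c A B)
  have "orbit_mean (\<lambda>z. c * character A B z) z = (\<lambda>T. c * orbit_mean (character A B) z T)"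
    by (simp add: orbit_mean_def fun_eq_iff)
  then show ?case
    using tendsto_mult_left[OF orbit_mean_character[OF z, of A B], of c] by simp
next
  case (trig_poly_add P Q)
  note cont = continuous_on_trig_poly[OF trig_poly_add(1)] continuous_on_trig_poly[OF trig_poly_add(2)]
  have "orbit_mean (\<lambda>z. P z + Q z) z = (\<lambda>T. orbit_mean P z T + orbit_mean Q z T)"
    by (simp add: orbit_mean_def fun_eq_iff integral_add integrable_on_orbit cont scaleR_add_right)
  then show ?case
    using tendsto_add[OF trig_poly_add.IH]
    by (simp add: Bochner_Integration.integral_add integrable_continuous_torus cont)
qed

text \<open>The real parts of trigonometric polynomials form an algebra, by
\<open>2 * Re p * Re q = Re (p * q + p * cnj q)\<close>, and the coordinates \<open>z j\<close> and \<open>-\<i> * z j\<close> separate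
points.\<close>

lemma trig_poly_dense:
  fixes f :: "(nat \<Rightarrow> complex) \<Rightarrow> real"
  assumes f: "continuous_on UNIV f" and e: "e > 0"
  obtains P where "trig_poly P" "\<And>z. z \<in> space torus_measure \<Longrightarrow> \<bar>f z - Re (P z)\<bar> < e"
proof -
  interpret function_ring_on "{f. \<exists>P. trig_poly P \<and> f = (\<lambda>z. Re (P z))}" "space torus_measure"
  proof (standard, goal_cases)
    case 1 show ?case by (rule compact_torus)
  next
    case (2 f) then show ?case by (auto intro!: continuous_intros continuous_on_trig_poly)
  next
    case (3 f g)
    then obtain P Q where "trig_poly P" "trig_poly Q" "f = (\<lambda>z. Re (P z))" "g = (\<lambda>z. Re (Q z))" by auto
    then show ?case by (auto intro!: exI[of _ "\<lambda>z. P z + Q z"] trig_poly_add)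
  next
    case (4 f g)
    then obtain P Q where PQ: "trig_poly P" "trig_poly Q" "f = (\<lambda>z. Re (P z))" "g = (\<lambda>z. Re (Q z))" by auto
    have "trig_poly (\<lambda>z. (1/2) * (P z * Q z + P z * cnj (Q z)))"
      by (intro trig_poly_mult trig_poly_add trig_poly_cnj trig_poly_const PQ)
    with PQ(3,4) show ?case
      by (auto intro!: exI[of _ "\<lambda>z. (1/2) * (P z * Q z + P z * cnj (Q z))"])
  next
    case (5 c) show ?case
      by (auto intro!: exI[of _ "\<lambda>_. complex_of_real c"] trig_poly_const)
  next
    case (6 x y)
    then obtain j where j: "x j \<noteq> y j" by auto
    have P: "trig_poly (\<lambda>z. c * z j)" for c
      using trig_poly_monomial[of c "{#j#}" "{#}"] by (simp add: character_def)
    show ?case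
    proof (cases "Re (x j) = Re (y j)")
      case False
      then show ?thesis using P[of 1] by (intro bexI[of _ "\<lambda>z. Re (1 * z j)"]) auto
    next
      case True
      then have "Im (x j) \<noteq> Im (y j)" using j by (simp add: complex_eq_iff)
      then show ?thesis using P[of "-\<i>"] by (intro bexI[of _ "\<lambda>z. Re (-\<i> * z j)"]) auto
    qed
  qed
  obtain g where "g \<in> {f. \<exists>P. trig_poly P \<and> f = (\<lambda>z. Re (P z))}" "\<forall>z\<in>space torus_measure. \<bar>f z - g z\<bar> < e"
    using Stone_Weierstrass_basic[OF continuous_on_subset[OF f] e] by auto
  then show thesis using that by auto
qed

text \<open>Replacing \<open>f\<close> by a uniformly close trigonometric polynomial changes the means and the
integral by a small amount that does not depend on \<open>T\<close>. Convergence therefore holds on every orbit.\<close>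

lemma continuous_orbit_mean:
  fixes f :: "(nat \<Rightarrow> complex) \<Rightarrow> real"
  assumes f: "continuous_on UNIV f" and z: "z \<in> space torus_measure"
  shows "(orbit_mean f z \<longlongrightarrow> (LINT w|torus_measure. f w)) at_top"
proof (rule tendstoI)
  fix e :: real assume e: "e > 0"
  obtain P where P: "trig_poly P" and close: "\<And>w. w \<in> space torus_measure \<Longrightarrow> \<bar>f w - Re (P w)\<bar> < e / 4"
    using trig_poly_dense[OF f, of "e / 4"] e by auto
  have contP: "continuous_on UNIV P" and contR: "continuous_on UNIV (\<lambda>w. Re (P w))"
    by (auto intro!: continuous_intros continuous_on_trig_poly P)
  have intR: "(LINT w|torus_measure. Re (P w)) = Re (LINT w|torus_measure. P w)"
    by (rule integral_bounded_linear[OF bounded_linear_Re integrable_continuous_torus[OF contP]])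
  have meanR: "orbit_mean (\<lambda>w. Re (P w)) z T = Re (orbit_mean P z T)" for T
    using integral_linear[OF integrable_on_orbit[OF contP, where z=z and a="-T" and b=T] bounded_linear_Re]
    by (simp add: orbit_mean_def o_def)
  have "\<bar>(LINT w|torus_measure. f w) - (LINT w|torus_measure. Re (P w))\<bar> = \<bar>LINT w|torus_measure. f w - Re (P w)\<bar>"
    by (simp add: integrable_continuous_torus f contR)
  also have "\<dots> \<le> (LINT w|torus_measure. \<bar>f w - Re (P w)\<bar>)"
    by (rule integral_abs_bound)
  also have "\<dots> \<le> (LINT w|torus_measure. e / 4)"
    using close by (intro integral_mono integrable_continuous_torus continuous_intros f contR) (auto intro: less_imp_le)
  finally have 1: "\<bar>(LINT w|torus_measure. f w) - (LINT w|torus_measure. Re (P w))\<bar> \<le> e / 4"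
    by (simp add: kronecker.prob_space)
  have 2: "\<bar>orbit_mean f z T - orbit_mean (\<lambda>w. Re (P w)) z T\<bar> \<le> e / 4" if T: "T > 0" for T
  proof -
    let ?g = "\<lambda>t. f (torus_mult z (kronecker_flow t)) - Re (P (torus_mult z (kronecker_flow t)))"
    have bound: "norm (integral {-T..T} ?g) \<le> e / 4 * (T - (-T))"
    proof (rule integral_bound)
      show "continuous_on {-T..T} ?g"
        by (intro continuous_on_diff continuous_on_orbit f contR)
    qed (use T close torus_mult_flow_in_space[OF z] in \<open>auto intro: less_imp_le\<close>)
    have "orbit_mean f z T - orbit_mean (\<lambda>w. Re (P w)) z T = (1 / (2 * T)) * integral {-T..T} ?g"
      unfolding orbit_mean_def
      using integrable_on_orbit[OF f] integrable_on_orbit[OF contR]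
      by (subst integral_diff) (auto simp: right_diff_distrib)
    also have "\<bar>\<dots>\<bar> \<le> (1 / (2 * T)) * (e / 4 * (T - (-T)))"
      unfolding abs_mult using bound T by (intro mult_mono) auto
    also have "\<dots> = e / 4" using T by (simp add: field_simps)
    finally show ?thesis .
  qed
  have "((\<lambda>T. Re (orbit_mean P z T)) \<longlongrightarrow> Re (LINT w|torus_measure. P w)) at_top"
    by (intro tendsto_Re trig_poly_orbit_mean z P)
  then have "\<forall>\<^sub>F T in at_top. dist (Re (orbit_mean P z T)) (Re (LINT w|torus_measure. P w)) < e / 4"
    using e by (intro tendstoD) auto
  then show "\<forall>\<^sub>F T in at_top. dist (orbit_mean f z T) (LINT w|torus_measure. f w) < e"
    using eventually_gt_at_top[of 0]
  proof eventually_elim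
    case (elim T)
    show ?case
      using elim(1) 1 2[OF elim(2)] e unfolding meanR intR dist_real_def by linarith
  qed
qed

section \<open>The ergodic theorem for the Kronecker flow\<close>

lemma averages_converge_continuous:
  fixes f :: "(nat \<Rightarrow> complex) \<Rightarrow> real"
  assumes f: "continuous_on UNIV f" and nonneg: "\<And>w. f w \<ge> 0"
  shows "kronecker.averages_converge (\<lambda>w. ennreal (f w))"
  unfolding kronecker.averages_converge_def
proof (rule AE_I2)
  fix z assume z: "z \<in> space torus_measure"
  have "kronecker.orbit_average (\<lambda>w. ennreal (f w)) z T = ennreal (orbit_mean f z T)" if T: "T > 0" for T
  proof -
    let ?g = "\<lambda>t. f (torus_mult z (kronecker_flow t))"
    have int: "set_integrable lborel {-T..T} ?g"
      by (intro borel_integrable_atLeastAtMost' continuous_on_orbit f)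
    have "(\<integral>\<^sup>+t\<in>{-T..T}. ennreal (?g t) \<partial>lborel) = (\<integral>\<^sup>+t. ennreal (indicator {-T..T} t *\<^sub>R ?g t) \<partial>lborel)"
      by (intro nn_integral_cong) (auto simp: indicator_def)
    also have "\<dots> = ennreal (LINT t:{-T..T}|lborel. ?g t)"
      unfolding set_lebesgue_integral_def
      using int nonneg by (intro nn_integral_eq_integral) (auto simp: set_integrable_def)
    also have "(LINT t:{-T..T}|lborel. ?g t) = integral {-T..T} ?g"
      by (rule set_borel_integral_eq_integral(2)[OF int])
    finally show ?thesis
      unfolding kronecker.orbit_average_def orbit_mean_def
      using T nonneg by (simp add: integral_nonneg integrable_on_orbit f flip: ennreal_mult)
  qed
  then have ev: "\<forall>\<^sub>F T in at_top. ennreal (orbit_mean f z T) = kronecker.orbit_average (\<lambda>w. ennreal (f w)) z T"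
    by (intro eventually_mono[OF eventually_gt_at_top[of 0]]) simp
  have "((\<lambda>T. ennreal (orbit_mean f z T)) \<longlongrightarrow> ennreal (LINT w|torus_measure. f w)) at_top"
    by (intro tendsto_ennrealI continuous_orbit_mean f z)
  moreover have "(\<integral>\<^sup>+w. ennreal (f w) \<partial>torus_measure) = ennreal (LINT w|torus_measure. f w)"
    using nonneg by (intro nn_integral_eq_integral integrable_continuous_torus f) auto
  ultimately show "(kronecker.orbit_average (\<lambda>w. ennreal (f w)) z \<longlongrightarrow> (\<integral>\<^sup>+w. ennreal (f w) \<partial>torus_measure)) at_top"
    using tendsto_cong[OF ev] by simp
qed

text \<open>The indicator of \<open>U\<close> is the increasing limit of the continuous functions
\<open>min 1 (k * infdist w (- U))\<close>. The whole space is treated apart because \<open>infdist\<close> to the empty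
set is zero by convention.\<close>

lemma averages_converge_open:
  assumes U: "open U"
  shows "kronecker.averages_converge (indicator (U \<inter> space torus_measure))"
proof (cases "U = UNIV")
  case True
  have "kronecker.averages_converge (\<lambda>w. ennreal 1)"
    by (intro averages_converge_continuous continuous_intros) simp
  then show ?thesis
    using True by (subst kronecker.averages_converge_cong[of _ "\<lambda>w. ennreal 1"]) auto
next
  case False
  define f where "f k w = min 1 (real k * infdist w (- U))" for k w
  define V where "V k = (\<lambda>w. ennreal (f k w))" for k
  have cont: "continuous_on UNIV (f k)" for k
    unfolding f_def by (intro continuous_intros)
  have V: "kronecker.averages_converge (V k)" for k
    unfolding V_def by (intro averages_converge_continuous cont) (simp add: f_def infdist_nonneg)
  have meas: "V k \<in> borel_measurable torus_measure" for k
    unfolding V_def using borel_measurable_continuous_torus[OF cont] by measurable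
  have inc: "incseq V"
    unfolding V_def incseq_def le_fun_def f_def
    by (intro allI impI ennreal_leI min.mono mult_right_mono) (auto simp: infdist_nonneg)
  have "(SUP k. V k w) = indicator U w" for w
  proof (cases "w \<in> U")
    case True
    then have pos: "infdist w (- U) > 0"
      using False U infdist_pos_not_in_closed[of "-U" w] by auto
    obtain k where "1 / infdist w (- U) < real k" using reals_Archimedean2 by blast
    then have "V k w = 1" using pos by (simp add: V_def f_def field_simps min_absorb1)
    then have "1 \<le> (SUP k. V k w)" by (metis SUP_upper UNIV_I)
    moreover have "(SUP k. V k w) \<le> 1"
      by (intro SUP_least) (simp add: V_def f_def)
    ultimately have "(SUP k. V k w) = 1" by (rule antisym[rotated])
    then show ?thesis using True by simp
  next
    case False
    then show ?thesis by (simp add: V_def f_def)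
  qed
  moreover have "kronecker.averages_converge (SUP k. V k)"
    by (intro kronecker.averages_converge_SUP meas inc V)
  ultimately show ?thesis
    by (subst kronecker.averages_converge_cong[of _ "SUP k. V k"]) (auto simp: image_comp indicator_def)
qed

text \<open>One inclusion holds because the coordinates are continuous. The other says that the
product \<open>\<sigma>\<close>-algebra contains the open sets, which uses that the product topology of countably many
copies of the complex plane has a countable basis.\<close>

lemma sets_torus_measure:
  "sets torus_measure = sigma_sets (space torus_measure) {U \<inter> space torus_measure |U. open U}"
proof
  let ?G = "{U \<inter> space torus_measure |U. open U}"
  let ?S = "sigma (space torus_measure) ?G"
  have sub: "?G \<subseteq> Pow (space torus_measure)" by auto
  have "(\<lambda>z. z) \<in> measurable ?S torus_measure"
  proof (rule measurable_torus_measureI)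
    show "(\<lambda>x. x j) \<in> borel_measurable ?S" for j
    proof (rule borel_measurableI)
      fix W :: "complex set" assume "open W"
      then have "open ((\<lambda>z. z j) -` W)"
        by (intro open_vimage continuous_on_product_coordinates)
      then show "(\<lambda>x. x j) -` W \<inter> space ?S \<in> sets ?S"
        using sub by (auto intro!: sigma_sets.Basic simp: space_measure_of_conv)
    qed
  qed (simp add: space_torus_measure space_measure_of_conv)
  then have "A \<in> sets ?S" if "A \<in> sets torus_measure" for A
    using measurable_sets[OF _ that, of "\<lambda>z. z" ?S] sets.sets_into_space[OF that]
    by (simp add: space_measure_of_conv Int_absorb2)
  then show "sets torus_measure \<subseteq> sigma_sets (space torus_measure) ?G"
    using sub by auto
  show "sigma_sets (space torus_measure) ?G \<subseteq> sets torus_measure"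
    using measurable_sets[OF measurable_torus_borel] by (intro sets.sigma_sets_subset) auto
qed

theorem kronecker_flow_average_converges:
  assumes "G \<in> borel_measurable torus_measure"
  shows "AE z in torus_measure. (flow_average G z \<longlongrightarrow> (\<integral>\<^sup>+w. G w \<partial>torus_measure)) at_top"
proof -
  have "kronecker.averages_converge G"
  proof (rule kronecker.averages_converge_of_generator[OF sets_torus_measure])
    show "Int_stable {U \<inter> space torus_measure |U. open U}"
    proof (rule Int_stableI)
      fix A B assume "A \<in> {U \<inter> space torus_measure |U. open U}" "B \<in> {U \<inter> space torus_measure |U. open U}"
      then obtain U V where "open U" "A = U \<inter> space torus_measure" "open V" "B = V \<inter> space torus_measure" by blast
      then show "A \<inter> B \<in> {U \<inter> space torus_measure |U. open U}"
        by (auto intro!: exI[of _ "U \<inter> V"])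
    qed
  qed (use assms averages_converge_open in auto)
  then show ?thesis
    by (simp add: kronecker.averages_converge_def flow_average_eq_orbit_average)
qed

text \<open>By \<open>AE_orbit\<close> the two functions agree at almost every time on almost every orbit, and integrals over
time do not see the remaining times. The lemma transfers averages from Borel functions to functions
that are measurable only for the completed measure, whose restrictions to single orbits may
fail to be measurable.\<close>

lemma flow_average_cong_AE:
  assumes "AE w in torus_measure. G w = H w"
  shows "AE z in torus_measure. flow_average G z = flow_average H z"
  using kronecker.AE_orbit[OF assms]
proof eventually_elim
  case (elim z)
  have "flow_average G z T = flow_average H z T" for T
    unfolding flow_average_eq_orbit_average kronecker.orbit_average_def
    by (intro arg_cong2[where f="(*)"] refl nn_integral_cong_AE eventually_mono[OF elim]) simp
  then show ?case by blast
qed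

section \<open>Fatou's lemma along the flow\<close>

theorem theorem3p3:
  fixes F :: "nat \<Rightarrow> (nat \<Rightarrow> complex) \<Rightarrow> ennreal"
  assumes "\<And>n. n \<ge> 1 \<Longrightarrow> F n \<in> borel_measurable (completion torus_measure)"
  shows "AE z in completion torus_measure.
    \<exists>L l. (flow_average (\<lambda>w. liminf (\<lambda>n. F n w)) z \<longlongrightarrow> L) at_top \<and>
          (\<forall>n\<ge>1. (flow_average (F n) z \<longlongrightarrow> l n) at_top) \<and>
          L \<le> liminf l"
proof -
  have "\<exists>H. H \<in> borel_measurable torus_measure \<and> (n \<ge> 1 \<longrightarrow> (AE w in torus_measure. F n w = H w))" for n
  proof (cases "n \<ge> 1")
    case True
    then show ?thesis using completion_ex_borel_measurable[OF assms[OF True]] by blast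
  next
    case False
    then show ?thesis by (intro exI[of _ "\<lambda>_. 0"]) simp
  qed
  then have "\<exists>H. \<forall>n. H n \<in> borel_measurable torus_measure \<and> (n \<ge> 1 \<longrightarrow> (AE w in torus_measure. F n w = H n w))"
    by (intro choice allI)
  then obtain H where [measurable]: "\<And>n. H n \<in> borel_measurable torus_measure"
    and FH: "\<And>n. n \<ge> 1 \<Longrightarrow> AE w in torus_measure. F n w = H n w" by blast
  have "AE w in torus_measure. \<forall>n. n \<ge> 1 \<longrightarrow> F n w = H n w"
    unfolding AE_all_countable using FH by auto
  then have liminf_eq: "AE w in torus_measure. liminf (\<lambda>n. F n w) = liminf (\<lambda>n. H n w)"
  proof eventually_elim
    case (elim w)
    then show ?case
      by (intro Liminf_eq eventually_mono[OF eventually_ge_at_top[of 1]]) auto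
  qed
  have "AE z in torus_measure. \<forall>n. (flow_average (H n) z \<longlongrightarrow> (\<integral>\<^sup>+w. H n w \<partial>torus_measure)) at_top"
    unfolding AE_all_countable by (intro allI kronecker_flow_average_converges) measurable
  moreover have "AE z in torus_measure. \<forall>n. n \<ge> 1 \<longrightarrow> flow_average (F n) z = flow_average (H n) z"
    unfolding AE_all_countable using flow_average_cong_AE[OF FH] by (intro allI AE_impI)
  moreover have "AE z in torus_measure.
      (flow_average (\<lambda>w. liminf (\<lambda>n. H n w)) z \<longlongrightarrow> (\<integral>\<^sup>+w. liminf (\<lambda>n. H n w) \<partial>torus_measure)) at_top"
    by (intro kronecker_flow_average_converges) measurable
  moreover note flow_average_cong_AE[OF liminf_eq]
  ultimately have "AE z in torus_measure.
    \<exists>L l. (flow_average (\<lambda>w. liminf (\<lambda>n. F n w)) z \<longlongrightarrow> L) at_top \<and>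
          (\<forall>n\<ge>1. (flow_average (F n) z \<longlongrightarrow> l n) at_top) \<and>
          L \<le> liminf l"
  proof eventually_elim
    case (elim z)
    have "(\<integral>\<^sup>+w. liminf (\<lambda>n. H n w) \<partial>torus_measure) \<le> liminf (\<lambda>n. \<integral>\<^sup>+w. H n w \<partial>torus_measure)"
      by (intro nn_integral_liminf) measurable
    with elim show ?case
      by (intro exI[of _ "\<integral>\<^sup>+w. liminf (\<lambda>n. H n w) \<partial>torus_measure"]
            exI[of _ "\<lambda>n. \<integral>\<^sup>+w. H n w \<partial>torus_measure"]) simp
  qed
  then show ?thesis by (rule AE_completion)
qed

end
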